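(* For every real $m>0$, the function $f:(0,\infty)\to\mathbb{R}$ given by \[ f(x)=\frac{1}{m}\sinh\frac{m}{x}-\psi'(x+1) \] is completely monotonic.
   Context: An infinitely differentiable function $f:(0,\infty)\to\mathbb{R}$ is called completely monotonic if $(-1)^n f^{(n)}(x)\ge 0$ for all $x>0$ and all $n=0,1,2,\dots$ (where $f^{(0)}=f$). Here $\psi(x)=\Gamma'(x)/\Gamma(x)$, $x>0$, is the digamma function, where $\Gamma$ is Euler's gamma function, and $\psi'$ is the derivative of $\psi$. *)

theory Defs
  imports "HOL-Analysis.Analysis"
begin

(* Functions on the open half-line are represented by total functions on the reals. Only their
   values at positive arguments matter: at x > 0 each iterated derivative depends only on the
   values near x. Since deriv is total, differentiability of every iterated derivative is
   required explicitly. *)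
definition completely_monotonic :: "(real \<Rightarrow> real) \<Rightarrow> bool" where
  "completely_monotonic f \<longleftrightarrow>
     (\<forall>n. \<forall>x>0. (deriv ^^ n) f field_differentiable at x) \<and>
     (\<forall>n. \<forall>x>0. (-1) ^ n * (deriv ^^ n) f x \<ge> 0)"

(* The library introduces Digamma by its series; this is the logarithmic-derivative form. *)
lemma Digamma_eq_deriv_Gamma:
  fixes x :: real
  assumes "x > 0"
  shows "Digamma x = deriv Gamma x / Gamma x"
proof -
  have "x \<notin> \<int>\<^sub>\<le>\<^sub>0"
    using assms by (auto elim!: nonpos_Ints_cases)
  then have "(Gamma has_field_derivative (Gamma x * Digamma x)) (at x)"
    by (rule has_field_derivative_Gamma)
  then show ?thesis
    using Gamma_real_pos[OF assms] by (simp add: DERIV_imp_deriv)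
qed

end

theory Submission
  imports Defs
begin

text \<open>
  Expanding the hyperbolic sine, the function is the sum of
  \<open>(\<Sum>k\<ge>1. m^(2k) / ((2k+1)! x^(2k+1)))\<close>, a power series in \<open>1/x\<close> with nonnegative
  coefficients, and of \<open>1/x - \<psi>'(x+1)\<close>. For the latter, telescoping
  \<open>1/x^(n+1) = (\<Sum>k. 1/(x+k)^(n+1) - 1/(x+k+1)^(n+1))\<close> and comparing with the series of the
  polygamma functions reduces the sign of the \<open>n\<close>-th derivative to Bernoulli's inequality.
\<close>

text \<open>Replaces the iterated \<open>deriv\<close> by an explicit family \<open>g\<close> of
  successive derivatives. Agreement on x > 0 suffices at each induction step, because that half-line
  is open and derivatives are local.\<close>

lemma completely_monotonicI:
  assumes eq: "\<And>x. x > 0 \<Longrightarrow> f x = g 0 x"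
    and deriv: "\<And>n x. x > 0 \<Longrightarrow> (g n has_real_derivative g (Suc n) x) (at x)"
    and nonneg: "\<And>n x. x > 0 \<Longrightarrow> (-1) ^ n * g n x \<ge> 0"
  shows "completely_monotonic f"
proof -
  have *: "(h has_real_derivative g (Suc n) x) (at x)"
    if "\<And>y. y > 0 \<Longrightarrow> h y = g n y" "x > 0" for h n x
  proof (rule has_field_derivative_transform_within_open[OF deriv])
    show "open {0::real<..}" by simp
  qed (use that in auto)
  have D: "(deriv ^^ n) f x = g n x" if "x > 0" for n x
    using that
  proof (induction n arbitrary: x)
    case (Suc n)
    show ?case
      using *[OF Suc.IH, where x = x] Suc.prems by (simp add: DERIV_imp_deriv)
  qed (simp add: eq)
  show ?thesis
    unfolding completely_monotonic_def
    using *[OF D] D nonneg by (auto simp: field_differentiable_def)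
qed

lemma completely_monotonic_add:
  assumes "completely_monotonic f" "completely_monotonic g"
  shows "completely_monotonic (\<lambda>x. f x + g x)"
proof (rule completely_monotonicI[where g = "\<lambda>n x. (deriv ^^ n) f x + (deriv ^^ n) g x"])
  show "((\<lambda>x. (deriv ^^ n) f x + (deriv ^^ n) g x) has_real_derivative
          (deriv ^^ Suc n) f x + (deriv ^^ Suc n) g x) (at x)" if "x > 0" for n x
    using assms that unfolding completely_monotonic_def
    by (auto intro!: DERIV_add simp: DERIV_deriv_iff_field_differentiable)
qed (use assms in \<open>auto simp: completely_monotonic_def distrib_left\<close>)

text \<open>
  Differentiating \<open>h(1/x)\<close> gives \<open>-(t\<^sup>2 h'(t))\<close> at \<open>t = 1/x\<close>, and \<open>t\<^sup>2 h'(t)\<close> is again a power series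
  with nonnegative coefficients.
\<close>

lemma DERIV_powser_inverse:
  fixes a :: "nat \<Rightarrow> real"
  assumes summable: "\<And>t. summable (\<lambda>k. a k * t ^ k)" and "x > 0"
  defines "b \<equiv> \<lambda>k. real (k - 1) * a (k - 1)"
  shows "summable (\<lambda>k. b k * t ^ k)"
    and "((\<lambda>x. \<Sum>k. a k * (1 / x) ^ k) has_real_derivative - (\<Sum>k. b k * (1 / x) ^ k)) (at x)"
proof -
  have b_sums: "(\<lambda>k. b k * t ^ k) sums (t\<^sup>2 * (\<Sum>k. diffs a k * t ^ k))" for t
  proof -
    have "(\<lambda>k. t\<^sup>2 * (diffs a k * t ^ k)) sums (t\<^sup>2 * (\<Sum>k. diffs a k * t ^ k))"
      by (intro sums_mult summable_sums termdiff_converges_all summable)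
    also have "(\<lambda>k. t\<^sup>2 * (diffs a k * t ^ k)) = (\<lambda>k. b (k + 2) * t ^ (k + 2))"
      by (simp add: b_def diffs_def fun_eq_iff power2_eq_square algebra_simps)
    \<comment> \<open>The shift by two drops nothing: \<open>b 0 = 0\<close> because
      \<open>0 - 1 = 0\<close> in the naturals, and \<open>b 1 = 0\<close> because its factor
      vanishes.\<close>
    finally show ?thesis
      by (subst (asm) sums_iff_shift) (simp add: b_def numeral_2_eq_2)
  qed
  show "summable (\<lambda>k. b k * t ^ k)"
    using b_sums by (rule sums_summable)
  have "((\<lambda>t. \<Sum>k. a k * t ^ k) has_real_derivative (\<Sum>k. diffs a k * (1 / x) ^ k)) (at (1 / x))"
    by (rule termdiffs_strong_converges_everywhere[OF summable])
  moreover have "((\<lambda>x. 1 / x) has_real_derivative - ((1 / x)\<^sup>2)) (at x)"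
    using \<open>x > 0\<close> by (auto intro!: derivative_eq_intros simp: power2_eq_square)
  ultimately have "((\<lambda>x. \<Sum>k. a k * (1 / x) ^ k) has_real_derivative
      (\<Sum>k. diffs a k * (1 / x) ^ k) * - ((1 / x)\<^sup>2)) (at x)"
    by (rule DERIV_chain2)
  then show "((\<lambda>x. \<Sum>k. a k * (1 / x) ^ k) has_real_derivative - (\<Sum>k. b k * (1 / x) ^ k)) (at x)"
    using b_sums[of "1 / x"] by (simp add: sums_iff mult_ac)
qed

text \<open>Each differentiation in x contributes one minus sign and otherwise maps nonnegative
  coefficients to nonnegative coefficients, so the signs alternate exactly as required.\<close>

lemma completely_monotonic_powser_inverse:
  fixes a :: "nat \<Rightarrow> real"
  assumes summable: "\<And>t. summable (\<lambda>k. a k * t ^ k)" and nonneg: "\<And>k. a k \<ge> 0"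
  shows "completely_monotonic (\<lambda>x. \<Sum>k. a k * (1 / x) ^ k)"
proof -
  \<comment> \<open>\<open>c n\<close> holds the coefficients, in powers of 1/x, of (-1)^n times the
    n-th derivative.\<close>
  define c where "c n = ((\<lambda>b k. real (k - 1) * b (k - 1)) ^^ n) a" for n
  have c_Suc: "c (Suc n) = (\<lambda>k. real (k - 1) * c n (k - 1))" for n
    by (simp add: c_def)
  have c_summable: "summable (\<lambda>k. c n k * t ^ k)" for n t
  proof (induction n arbitrary: t)
    case (Suc n)
    show ?case
      unfolding c_Suc by (rule DERIV_powser_inverse(1)[OF Suc.IH zero_less_one])
  qed (simp add: c_def summable)
  have c_nonneg: "c n k \<ge> 0" for n k
    by (induction n arbitrary: k) (auto simp: c_Suc, simp add: c_def nonneg)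
  show ?thesis
  proof (rule completely_monotonicI[where g = "\<lambda>n x. (-1) ^ n * (\<Sum>k. c n k * (1 / x) ^ k)"])
    fix n :: nat and x :: real
    assume "x > 0"
    show "((\<lambda>x. (-1) ^ n * (\<Sum>k. c n k * (1 / x) ^ k)) has_real_derivative
            (-1) ^ Suc n * (\<Sum>k. c (Suc n) k * (1 / x) ^ k)) (at x)"
      using DERIV_cmult[OF DERIV_powser_inverse(2)[OF c_summable \<open>x > 0\<close>], of "(-1) ^ n" n]
      by (simp add: c_Suc)
    have "(\<Sum>k. c n k * (1 / x) ^ k) \<ge> 0"
      using \<open>x > 0\<close> by (intro suminf_nonneg c_summable) (simp add: c_nonneg)
    then show "(-1) ^ n * ((-1) ^ n * (\<Sum>k. c n k * (1 / x) ^ k)) \<ge> 0"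
      by (simp flip: mult.assoc power_mult_distrib)
  qed (simp add: c_def)
qed

text \<open>Bernoulli's inequality for (1 + 1/y)^n, multiplied by y^n. With y = x + k it bounds a
  term of a polygamma series by a telescoping difference.\<close>

lemma inverse_power_diff_ge:
  fixes y :: real
  assumes "y > 0"
  shows "real n * inverse ((y + 1) ^ Suc n) \<le> inverse (y ^ n) - inverse ((y + 1) ^ n)"
proof -
  have "1 + real n * (1 / y) \<le> (1 + 1 / y) ^ n"
    using assms by (intro Bernoulli_inequality) (simp add: order_trans[of _ 0])
  \<comment> \<open>Weakening n/y to n/(y + 1) leaves only powers of y + 1 on the left after
    dividing by (y + 1)^n.\<close>
  moreover have "real n * (1 / (y + 1)) \<le> real n * (1 / y)"
    using assms by (intro mult_left_mono) (auto simp: frac_le)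
  ultimately have "(1 + real n / (y + 1)) * y ^ n \<le> (1 + 1 / y) ^ n * y ^ n"
    using assms by (intro mult_right_mono) auto
  also have "\<dots> = (y + 1) ^ n"
    using assms by (simp add: field_simps flip: power_mult_distrib)
  finally have "(1 + real n / (y + 1)) / (y + 1) ^ n \<le> 1 / y ^ n"
    using assms by (simp add: pos_divide_le_eq pos_le_divide_eq)
  then show ?thesis
    by (simp add: add_divide_distrib inverse_eq_divide)
qed

text \<open>Termwise comparison of the polygamma series with the telescoping series for
  1/x^(n+1).\<close>

lemma Polygamma_plus1_bound:
  fixes x :: real
  assumes "x > 0"
  shows "(-1) ^ n * Polygamma (Suc n) (x + 1) \<le> fact n / x ^ Suc n"
proof -
  have "(\<lambda>k. inverse ((x + 1 + real k) ^ Suc (Suc n))) sums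
      ((-1) ^ Suc (Suc n) * Polygamma (Suc n) (x + 1) / fact (Suc n))"
    using assms by (intro Polygamma_LIMSEQ) auto
  \<comment> \<open>The factor n + 1 turns \<open>fact (Suc n)\<close> into \<open>fact n\<close>
    and gives the terms the shape of \<open>inverse_power_diff_ge\<close> at exponent
    \<open>Suc n\<close>.\<close>
  from sums_mult[OF this, of "real (Suc n)"]
  have "(\<lambda>k. real (Suc n) * inverse ((x + real k + 1) ^ Suc (Suc n))) sums
      ((-1) ^ n * Polygamma (Suc n) (x + 1) / fact n)"
    by (simp add: add_ac del: of_nat_Suc power_Suc) simp
  moreover have "(\<lambda>k. inverse ((x + real k) ^ Suc n) - inverse ((x + real (Suc k)) ^ Suc n)) sums
      (inverse ((x + real 0) ^ Suc n) - 0)"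
  proof (rule telescope_sums')
    show "(\<lambda>k. inverse ((x + real k) ^ Suc n)) \<longlonglongrightarrow> 0"
      by (intro tendsto_inverse_0_at_top filterlim_pow_at_top filterlim_tendsto_add_at_top[OF tendsto_const]
          filterlim_real_sequentially) simp
  qed
  ultimately have "(-1) ^ n * Polygamma (Suc n) (x + 1) / fact n \<le> inverse (x ^ Suc n)"
    using inverse_power_diff_ge[of "x + real k" "Suc n" for k] assms
    by (elim sums_le[rotated]) (simp_all add: add_ac del: power_Suc)
  then show ?thesis
    by (simp add: field_simps)
qed

text \<open>The n-th derivative of 1/x is (-1)^n n!/x^(n+1), so the sign condition is exactly
  \<open>Polygamma_plus1_bound\<close>.\<close>

lemma completely_monotonic_inverse_minus_trigamma:
  "completely_monotonic (\<lambda>x. 1 / x - deriv Digamma (x + 1))"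
proof (rule completely_monotonicI
    [where g = "\<lambda>n x. (-1) ^ n * fact n / x ^ Suc n - Polygamma (Suc n) (x + 1)"])
  fix n :: nat and x :: real
  assume x: "x > 0"
  then have nonpole: "x + 1 \<notin> \<int>\<^sub>\<le>\<^sub>0"
    by (auto elim!: nonpos_Ints_cases)
  show "1 / x - deriv Digamma (x + 1) = (-1) ^ 0 * fact 0 / x ^ Suc 0 - Polygamma (Suc 0) (x + 1)"
    using deriv_Polygamma[OF nonpole, of 0] by simp
  have "((\<lambda>x. (-1) ^ n * fact n / x ^ Suc n) has_real_derivative
      (-1) ^ Suc n * fact (Suc n) / x ^ Suc (Suc n)) (at x)"
    by (rule derivative_eq_intros refl | use x in \<open>simp add: field_simps\<close>)+
  moreover have "((\<lambda>x. Polygamma (Suc n) (x + 1)) has_real_derivative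
      Polygamma (Suc (Suc n)) (x + 1)) (at x)"
    using nonpole by (auto intro!: derivative_eq_intros)
  ultimately show "((\<lambda>x. (-1) ^ n * fact n / x ^ Suc n - Polygamma (Suc n) (x + 1)) has_real_derivative
      (-1) ^ Suc n * fact (Suc n) / x ^ Suc (Suc n) - Polygamma (Suc (Suc n)) (x + 1)) (at x)"
    by (rule DERIV_diff)
  have "(-1) ^ n * ((-1) ^ n * fact n / x ^ Suc n) = fact n / x ^ Suc n"
    by (simp flip: mult.assoc power_mult_distrib)
  then show "(-1) ^ n * ((-1) ^ n * fact n / x ^ Suc n - Polygamma (Suc n) (x + 1)) \<ge> 0"
    using Polygamma_plus1_bound[OF x, of n] by (simp add: right_diff_distrib)
qed

lemma completely_monotonic_sinh_minus_inverse:
  fixes m :: real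
  assumes "m > 0"
  shows "completely_monotonic (\<lambda>x. 1 / m * sinh (m / x) - 1 / x)"
proof -
  \<comment> \<open>These are the Taylor coefficients of sinh(m t)/m - t. The index 1 is excluded
    because the linear term of sinh(m t)/m is exactly t, whatever m is; this is why 1/x is the right
    function to split off.\<close>
  define a where "a k = (if even k \<or> k = 1 then 0 else m ^ k / fact k / m)" for k :: nat
  have a_sums: "(\<lambda>k. a k * t ^ k) sums (1 / m * sinh (m * t) - t)" for t
  proof -
    have "(\<lambda>k. 1 / m * (if even k then 0 else (m * t) ^ k /\<^sub>R fact k) - (if k = 1 then t else 0))
        sums (1 / m * sinh (m * t) - t)"
      by (intro sums_diff sums_mult sinh_converges sums_single)
    also have "(\<lambda>k. 1 / m * (if even k then 0 else (m * t) ^ k /\<^sub>R fact k) - (if k = 1 then t else 0))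
        = (\<lambda>k. a k * t ^ k)"
      using assms by (auto simp: a_def fun_eq_iff field_simps)
    finally show ?thesis .
  qed
  have "completely_monotonic (\<lambda>x. \<Sum>k. a k * (1 / x) ^ k)"
    using assms by (intro completely_monotonic_powser_inverse sums_summable[OF a_sums])
      (simp add: a_def)
  then show ?thesis
    by (simp add: sums_unique[OF a_sums, symmetric])
qed

theorem proposition3p2:
  fixes m :: real
  assumes "m > 0"
  shows "completely_monotonic (\<lambda>x. 1 / m * sinh (m / x) - deriv Digamma (x + 1))"
  using completely_monotonic_add[OF completely_monotonic_sinh_minus_inverse[OF assms]
      completely_monotonic_inverse_minus_trigamma]
  by simp

end
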